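(* Let $W\colon\mathbb{R}\to\mathbb{R}$ be even ($W(x)=W(-x)$ for all $x\in\mathbb{R}$), continuously differentiable, and such that $W'(x)=0$ for all $|x|\geq 0.5$. Then the family of regularised energies $\{\mathcal{E}_\delta\}_{\delta>0}$ $\Gamma$-converges, as $\delta\to 0$, to the energy $\mathcal{E}$ with respect to the weak convergence of measures. That is: (Liminf) For any $\{\rho_\delta\}_{\delta>0}\subset\mathcal{P}_c(\mathbb{R})$ and $\rho\in\mathcal{P}_c(\mathbb{R})$ such that $\rho_\delta$ converges weakly to $\rho$ as $\delta\to 0$, we have $$\liminf_{\delta\to 0}\mathcal{E}_\delta(\rho_\delta)\geq\mathcal{E}(\rho).$$ (Limsup) For any $\rho\in\mathcal{P}_c(\mathbb{R})$ there exists $\{\rho_\delta\}_{\delta>0}\subset\mathcal{P}_c(\mathbb{R})$ such that $\rho_\delta$ converges weakly to $\rho$ as $\delta\to 0$ and $$\limsup_{\delta\to 0}\mathcal{E}_\delta(\rho_\delta)\leq\mathcal{E}(\rho).$$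
   Context: $\mathcal{P}_c(\mathbb{R})=\{\rho\in L^1_+(\mathbb{R}):\int_{\mathbb{R}}\rho\,\mathrm{d}x=1\}$, where $L^1_+$ denotes the nonnegative integrable functions; an element $\rho$ is identified with the probability measure $\rho\,\mathrm{d}x$. Weak convergence of measures means convergence of integrals against bounded continuous functions on $\mathbb{R}$. For $\rho\in\mathcal{P}_c(\mathbb{R})$, let $(W\ast\rho)(x)=\int_{\mathbb{R}}W(x-w)\rho(w)\,\mathrm{d}w$. The energies are $$\mathcal{E}(\rho)=\frac12\int_{\mathbb{R}}\rho\,(W\ast\rho)\,\mathrm{d}x,\qquad \mathcal{E}_\delta(\rho)=\frac12\int_{\mathbb{R}}\rho\,(W\ast\rho+\delta\rho)\,\mathrm{d}x\quad(\delta>0),$$ where $\mathcal{E}_\delta(\rho)=+\infty$ if $\rho\notin L^2(\mathbb{R})$. *)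

theory Defs
  imports "HOL-Analysis.Analysis"
begin

text \<open>
  Classes in $L^1$ and $L^2$ are represented by Borel measurable functions. Conditions on
  representatives are imposed only almost everywhere, and all notions below are invariant under
  changing a function on a null set.
\<close>

definition prob_densities :: "(real \<Rightarrow> real) set" where
  "prob_densities =
     {\<rho>. integrable lborel \<rho> \<and> (AE x in lborel. 0 \<le> \<rho> x) \<and> (\<integral>x. \<rho> x \<partial>lborel) = 1}"

definition density_measure :: "(real \<Rightarrow> real) \<Rightarrow> real measure" where
  "density_measure \<rho> = density lborel (\<lambda>x. ennreal (\<rho> x))"

text \<open>
  The library's \<open>weak_conv_m\<close> covers only sequences, and is phrased through distribution functions.
\<close>

definition weakly_converges :: "('i \<Rightarrow> real measure) \<Rightarrow> real measure \<Rightarrow> 'i filter \<Rightarrow> bool" where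
  "weakly_converges M N F \<longleftrightarrow>
     (\<forall>f :: real \<Rightarrow> real. continuous_on UNIV f \<and> bounded (range f) \<longrightarrow>
        ((\<lambda>i. \<integral>x. f x \<partial>M i) \<longlongrightarrow> (\<integral>x. f x \<partial>N)) F)"

definition in_L2 :: "(real \<Rightarrow> real) \<Rightarrow> bool" where
  "in_L2 \<rho> \<longleftrightarrow> \<rho> \<in> borel_measurable lborel \<and> integrable lborel (\<lambda>x. (\<rho> x)\<^sup>2)"

definition convol :: "(real \<Rightarrow> real) \<Rightarrow> (real \<Rightarrow> real) \<Rightarrow> real \<Rightarrow> real" where
  "convol W \<rho> x = (\<integral>w. W (x - w) * \<rho> w \<partial>lborel)"

text \<open>
  The Bochner integral is \<open>0\<close> for non-integrable functions. This default is never reached for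
  bounded continuous \<open>W\<close> and \<open>\<rho> \<in> prob_densities\<close>; the value \<open>\<infinity>\<close> of the regularised energy
  is therefore assigned explicitly.
\<close>

definition energy :: "(real \<Rightarrow> real) \<Rightarrow> (real \<Rightarrow> real) \<Rightarrow> real" where
  "energy W \<rho> = 1/2 * (\<integral>x. \<rho> x * convol W \<rho> x \<partial>lborel)"

definition reg_energy :: "(real \<Rightarrow> real) \<Rightarrow> real \<Rightarrow> (real \<Rightarrow> real) \<Rightarrow> ereal" where
  "reg_energy W \<delta> \<rho> =
     (if in_L2 \<rho> then ereal (1/2 * (\<integral>x. \<rho> x * (convol W \<rho> x + \<delta> * \<rho> x) \<partial>lborel)) else \<infinity>)"

text \<open>
  \<open>conv u v\<close> expresses that the family \<open>u\<close> converges to \<open>v\<close> as its parameter tends to \<open>0\<close> from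
  above; only the values \<open>u \<delta>\<close> for \<open>\<delta> > 0\<close> are meaningful.
\<close>

definition gamma_converges ::
  "'a set \<Rightarrow> ((real \<Rightarrow> 'a) \<Rightarrow> 'a \<Rightarrow> bool) \<Rightarrow> (real \<Rightarrow> 'a \<Rightarrow> ereal) \<Rightarrow> ('a \<Rightarrow> ereal) \<Rightarrow> bool" where
  "gamma_converges X conv E\<^sub>\<delta> E \<longleftrightarrow>
     (\<forall>u v. (\<forall>\<delta>>0. u \<delta> \<in> X) \<and> v \<in> X \<and> conv u v \<longrightarrow>
        E v \<le> Liminf (at_right 0) (\<lambda>\<delta>. E\<^sub>\<delta> \<delta> (u \<delta>))) \<and>
     (\<forall>v\<in>X. \<exists>u. (\<forall>\<delta>>0. u \<delta> \<in> X) \<and> conv u v \<and>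
        Limsup (at_right 0) (\<lambda>\<delta>. E\<^sub>\<delta> \<delta> (u \<delta>)) \<le> E v)"

end

theory Submission
  imports Defs "HOL-Probability.Distribution_Functions" "HOL-Real_Asymp.Real_Asymp"
begin

text \<open>
  Since \<open>W'\<close> is continuous and vanishes off a compact set, \<open>W\<close> is bounded and Lipschitz. Hence the
  potentials \<open>W \<star> \<mu>\<^sub>\<delta>\<close> are equibounded and equicontinuous, so along a weakly convergent family they
  converge locally uniformly; as a weakly convergent family is tight, \<open>\<E>\<close> is weakly continuous.
  The liminf inequality follows from \<open>\<E>\<^sub>\<delta> \<ge> \<E>\<close>. A recovery family is given by the truncations
  \<open>min \<rho> \<delta>\<^sup>-\<^sup>1\<^sup>/\<^sup>2\<close>, normalised to mass one: their squared \<open>L\<^sup>2\<close> norm is of order \<open>\<delta>\<^sup>-\<^sup>1\<^sup>/\<^sup>2\<close> at most,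
  so that the regularising term vanishes in the limit.
\<close>

section \<open>Interaction energies of weakly convergent measures\<close>

lemma (in real_distribution) borel_measurable_continuous:
  fixes f :: "real \<Rightarrow> real"
  assumes "continuous_on UNIV f"
  shows "f \<in> borel_measurable M"
  using borel_measurable_continuous_onI[OF assms] measurable_cong_sets[OF events_eq_borel refl]
  by blast

lemma (in real_distribution) integrable_bounded_continuous:
  fixes f :: "real \<Rightarrow> real"
  assumes "continuous_on UNIV f" "bounded (range f)"
  shows "integrable M f"
proof -
  obtain B where "\<And>x. \<bar>f x\<bar> \<le> B"
    using assms(2) by (auto simp: bounded_iff)
  then show ?thesis
    by (intro integrable_const_bound[where B=B])
       (auto intro!: borel_measurable_continuous assms(1))
qed

lemma (in prob_space) integral_abs_diff_le:
  fixes f g :: "'a \<Rightarrow> real"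
  assumes "integrable M f" "integrable M g" "\<And>x. \<bar>f x - g x\<bar> \<le> e"
  shows "\<bar>(\<integral>x. f x \<partial>M) - (\<integral>x. g x \<partial>M)\<bar> \<le> e"
proof -
  have "\<bar>(\<integral>x. f x \<partial>M) - (\<integral>x. g x \<partial>M)\<bar> = \<bar>\<integral>x. f x - g x \<partial>M\<bar>"
    using assms by simp
  also have "\<dots> \<le> (\<integral>x. \<bar>f x - g x\<bar> \<partial>M)"
    by (rule integral_abs_bound)
  also have "\<dots> \<le> (\<integral>x. e \<partial>M)"
    using assms by (intro integral_mono) auto
  finally show ?thesis
    by (simp add: prob_space)
qed

section \<open>Continuous cutoffs and tightness of a single measure\<close>

text \<open>A piecewise linear stand-in for the indicator of [-n, n]: weak convergence tests only
  continuous functions, so tightness is expressed through continuous cutoffs.\<close>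

definition cutoff :: "nat \<Rightarrow> real \<Rightarrow> real" where
  "cutoff n x = max 0 (min 1 (real n - \<bar>x\<bar>))"

lemma cutoff_range: "0 \<le> cutoff n x" "cutoff n x \<le> 1"
  by (auto simp: cutoff_def)

lemma cutoff_eq_0: "real n \<le> \<bar>x\<bar> \<Longrightarrow> cutoff n x = 0"
  by (auto simp: cutoff_def)

lemma continuous_on_cutoff: "continuous_on S (cutoff n)"
  unfolding cutoff_def by (intro continuous_intros)

lemma bounded_cutoff: "bounded (range (cutoff n))"
  using cutoff_range by (auto simp: bounded_iff intro!: exI[of _ 1])

text \<open>Dominated convergence: at each point the cutoffs are eventually equal to 1, and they are
  bounded by 1. This is tightness of one measure; weak convergence later passes it on to the
  family.\<close>

lemma (in real_distribution) integral_cutoff_tendsto: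
  "(\<lambda>n. \<integral>x. cutoff n x \<partial>M) \<longlonglongrightarrow> 1"
proof -
  have "(\<lambda>n. \<integral>x. cutoff n x \<partial>M) \<longlonglongrightarrow> (\<integral>x. 1 \<partial>M)"
  proof (rule integral_dominated_convergence[where w="\<lambda>_. 1"])
    show "AE x in M. (\<lambda>n. cutoff n x) \<longlonglongrightarrow> 1"
    proof (intro always_eventually allI)
      fix x :: real
      obtain m where m: "\<bar>x\<bar> + 1 \<le> real m"
        using real_arch_simple by blast
      have "eventually (\<lambda>n. cutoff n x = 1) sequentially"
        using eventually_ge_at_top[of m]
      proof eventually_elim
        case (elim n)
        then have "real m \<le> real n" by simp
        with m show ?case by (auto simp: cutoff_def)
      qed
      then show "(\<lambda>n. cutoff n x) \<longlonglongrightarrow> 1"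
        by (rule tendsto_eventually)
    qed
  qed (use cutoff_range in \<open>auto intro!: borel_measurable_continuous continuous_on_cutoff\<close>)
  then show ?thesis
    using prob_space by simp
qed

section \<open>Potentials of probability measures\<close>

text \<open>The two properties of the kernel that drive the limit: uniform continuity makes the
  potentials equicontinuous, and the bound \<open>B\<close> controls the contribution of the
  tails.\<close>

locale interaction_kernel =
  fixes W :: "real \<Rightarrow> real" and B :: real
  assumes unif: "uniformly_continuous_on UNIV W"
    and bound: "\<And>x. \<bar>W x\<bar> \<le> B"
begin

text \<open>Formulated for measures rather than densities, so that weak convergence applies to it
  directly.\<close>

definition potential :: "real measure \<Rightarrow> real \<Rightarrow> real" where
  "potential M x = (\<integral>y. W (x - y) \<partial>M)"

lemma continuous_shift: "continuous_on UNIV (\<lambda>y. W (x - y))"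
  by (intro continuous_on_compose2[OF uniformly_continuous_imp_continuous[OF unif]]
      continuous_intros) auto

lemma bounded_shift: "bounded (range (\<lambda>y. W (x - y)))"
  using bound by (auto simp: bounded_iff)

lemma integrable_shift:
  assumes "real_distribution M"
  shows "integrable M (\<lambda>y. W (x - y))"
  by (intro real_distribution.integrable_bounded_continuous assms continuous_shift bounded_shift)

lemma potential_bound:
  assumes "real_distribution M"
  shows "\<bar>potential M x\<bar> \<le> B"
proof -
  interpret real_distribution M by fact
  show ?thesis
    \<comment> \<open>Comparison with the zero function turns the estimate on differences into a
      bound.\<close>
    using integral_abs_diff_le[OF integrable_shift[OF assms] integrable_zero, of x B] bound
    by (simp add: potential_def)
qed

text \<open>A probability measure averages translates of \<open>W\<close>, which all share one
  modulus of continuity. Hence \<open>d\<close> is chosen before \<open>M\<close> and serves all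
  probability measures at once.\<close>

lemma potential_equicontinuous:
  assumes "e > 0"
  obtains d where "d > 0"
    "\<And>M x y. real_distribution M \<Longrightarrow> \<bar>x - y\<bar> < d \<Longrightarrow> \<bar>potential M x - potential M y\<bar> \<le> e"
proof -
  obtain d where d: "d > 0" "\<And>x y. \<bar>x - y\<bar> < d \<Longrightarrow> \<bar>W x - W y\<bar> < e"
    using unif assms unfolding uniformly_continuous_on_def dist_real_def by (metis UNIV_I)
  show ?thesis
  proof (rule that[OF d(1)])
    fix M and x y :: real
    assume M: "real_distribution M" and xy: "\<bar>x - y\<bar> < d"
    interpret real_distribution M by fact
    have "\<bar>W (x - z) - W (y - z)\<bar> \<le> e" for z
      using d(2)[of "x - z" "y - z"] xy by (simp add: less_imp_le)
    then show "\<bar>potential M x - potential M y\<bar> \<le> e"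
      unfolding potential_def by (intro integral_abs_diff_le integrable_shift M)
  qed
qed

lemma continuous_potential:
  assumes "real_distribution M"
  shows "continuous_on UNIV (potential M)"
  unfolding continuous_on_iff dist_real_def
proof (intro ballI allI impI)
  fix x e :: real
  assume "e > 0"
  then obtain d where "d > 0" "\<And>y. \<bar>y - x\<bar> < d \<Longrightarrow> \<bar>potential M y - potential M x\<bar> \<le> e / 2"
    using potential_equicontinuous[of "e / 2"] assms by (metis half_gt_zero)
  with \<open>e > 0\<close> show "\<exists>d>0. \<forall>y\<in>UNIV. \<bar>y - x\<bar> < d \<longrightarrow> \<bar>potential M y - potential M x\<bar> < e"
    by (intro exI[of _ d]) fastforce
qed

lemma bounded_potential:
  assumes "real_distribution M"
  shows "bounded (range (potential M))"
  using potential_bound[OF assms] by (auto simp: bounded_iff)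

lemma integrable_potential:
  assumes "real_distribution M" "real_distribution N"
  shows "integrable N (potential M)"
  by (intro real_distribution.integrable_bounded_continuous assms
      continuous_potential bounded_potential)

text \<open>For fixed \<open>x\<close>, the function \<open>W (x - y)\<close> of \<open>y\<close> is
  an admissible test function, so the potentials converge pointwise. Equicontinuity upgrades this to
  uniform convergence on \<open>K\<close> through a finite \<open>d\<close>-net \<open>T\<close>:
  two terms \<open>e / 3\<close> for moving to a net point, one for convergence there.\<close>

lemma potential_locally_uniform_limit:
  assumes M: "eventually (\<lambda>i. real_distribution (M i)) F" and N: "real_distribution N"
    and conv: "weakly_converges M N F" and K: "compact K" and "e > 0"
  shows "eventually (\<lambda>i. \<forall>x\<in>K. \<bar>potential (M i) x - potential N x\<bar> \<le> e) F"
proof -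
  obtain d where d: "d > 0"
    "\<And>M x y. real_distribution M \<Longrightarrow> \<bar>x - y\<bar> < d \<Longrightarrow> \<bar>potential M x - potential M y\<bar> \<le> e / 3"
    using potential_equicontinuous[of "e / 3"] \<open>e > 0\<close> by auto
  obtain T where T: "finite T" "K \<subseteq> (\<Union>t\<in>T. ball t d)"
    using compactE_image[OF K, of K "\<lambda>t. ball t d"] d(1)
    by (metis UN_I centre_in_ball open_ball subsetI)
  have lim: "((\<lambda>i. potential (M i) t) \<longlongrightarrow> potential N t) F" for t
    using conv continuous_shift bounded_shift
    unfolding weakly_converges_def potential_def by blast
  have "eventually (\<lambda>i. \<bar>potential (M i) t - potential N t\<bar> < e / 3) F" for t
    using tendstoD[OF lim[of t], of "e / 3"] \<open>e > 0\<close> by (simp add: dist_real_def)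
  then have "eventually (\<lambda>i. \<forall>t\<in>T. \<bar>potential (M i) t - potential N t\<bar> < e / 3) F"
    using T(1) by (simp add: eventually_ball_finite)
  with M show ?thesis
  proof eventually_elim
    case (elim i)
    show ?case
    proof
      fix x assume "x \<in> K"
      then obtain t where t: "t \<in> T" "\<bar>x - t\<bar> < d"
        using T(2) by (auto simp: dist_real_def abs_minus_commute)
      have "\<bar>potential (M i) x - potential (M i) t\<bar> \<le> e / 3"
        "\<bar>potential N x - potential N t\<bar> \<le> e / 3"
        "\<bar>potential (M i) t - potential N t\<bar> < e / 3"
        using d(2) elim N t by auto
      then show "\<bar>potential (M i) x - potential N x\<bar> \<le> e"
        by linarith
    qed
  qed
qed

text \<open>Integrand and measure vary together. On a large interval the integrand is uniformly
  small; outside it is at most \<open>2 * B\<close>, and little mass lies there by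
  tightness.\<close>

lemma integral_potential_diff_tendsto_0:
  assumes M: "eventually (\<lambda>i. real_distribution (M i)) F" and N: "real_distribution N"
    and conv: "weakly_converges M N F"
  shows "((\<lambda>i. \<integral>x. potential (M i) x - potential N x \<partial>M i) \<longlongrightarrow> 0) F"
proof (rule tendstoI)
  fix e :: real
  assume "e > 0"
  have "B \<ge> 0"
    using bound[of 0] by linarith
  \<comment> \<open>Chosen so that the final bound \<open>e' + 2 * B * e'\<close> equals
    \<open>e / 2\<close>; the summand 1 keeps the denominator positive when
    \<open>B = 0\<close>.\<close>
  define e' where "e' = e / (2 * (1 + 2 * B))"
  have "e' > 0"
    using \<open>e > 0\<close> \<open>B \<ge> 0\<close> by (simp add: e'_def)
  have "e' * (1 + 2 * B) = e / 2"
    using \<open>B \<ge> 0\<close> by (simp add: e'_def field_simps)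
  \<comment> \<open>The limit measure alone fixes \<open>n\<close>; using the cutoff as a test
    function then transfers the lower bound on the mass to \<open>M i\<close>.\<close>
  have "eventually (\<lambda>n. 1 - e' < (\<integral>x. cutoff n x \<partial>N)) sequentially"
    using real_distribution.integral_cutoff_tendsto[OF N] \<open>e' > 0\<close>
    by (simp add: order_tendsto_iff)
  then obtain n where "1 - e' < (\<integral>x. cutoff n x \<partial>N)"
    by (auto simp: eventually_sequentially)
  moreover have "((\<lambda>i. \<integral>x. cutoff n x \<partial>M i) \<longlongrightarrow> (\<integral>x. cutoff n x \<partial>N)) F"
    using conv continuous_on_cutoff bounded_cutoff unfolding weakly_converges_def by blast
  ultimately have tight: "eventually (\<lambda>i. 1 - e' < (\<integral>x. cutoff n x \<partial>M i)) F"
    by (simp add: order_tendsto_iff)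
  have "eventually (\<lambda>i. \<forall>x\<in>{-real n..real n}. \<bar>potential (M i) x - potential N x\<bar> \<le> e') F"
    by (intro potential_locally_uniform_limit M N conv \<open>e' > 0\<close>) auto
  with M tight
  show "eventually (\<lambda>i. dist (\<integral>x. potential (M i) x - potential N x \<partial>M i) 0 < e) F"
  proof eventually_elim
    case (elim i)
    interpret real_distribution "M i" by fact
    have int: "integrable (M i) (cutoff n)"
      by (intro integrable_bounded_continuous continuous_on_cutoff bounded_cutoff)
    \<comment> \<open>One bound valid everywhere, so the integral need not be split: outside the
      interval \<open>1 - cutoff n x\<close> is 1 and the crude bound \<open>2 * B\<close> applies,
      inside the extra term is merely nonnegative.\<close>
    have pt: "\<bar>potential (M i) x - potential N x\<bar> \<le> e' + 2 * B * (1 - cutoff n x)" for x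
    proof (cases "\<bar>x\<bar> \<le> real n")
      case True
      then have "x \<in> {-real n..real n}"
        by (simp add: abs_le_iff minus_le_iff)
      then have "\<bar>potential (M i) x - potential N x\<bar> \<le> e'"
        using elim(3) by blast
      moreover have "0 \<le> 2 * B * (1 - cutoff n x)"
        using \<open>B \<ge> 0\<close> cutoff_range by simp
      ultimately show ?thesis by linarith
    next
      case False
      then have "cutoff n x = 0"
        by (intro cutoff_eq_0) simp
      moreover have "\<bar>potential (M i) x\<bar> \<le> B" "\<bar>potential N x\<bar> \<le> B"
        using potential_bound elim(1) N by auto
      ultimately show ?thesis
        using \<open>e' > 0\<close> by simp
    qed
    have "\<bar>\<integral>x. potential (M i) x - potential N x \<partial>M i\<bar>
        \<le> (\<integral>x. \<bar>potential (M i) x - potential N x\<bar> \<partial>M i)"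
      by (rule integral_abs_bound)
    also have "\<dots> \<le> (\<integral>x. e' + 2 * B * (1 - cutoff n x) \<partial>M i)"
      using pt int integrable_potential[OF _ elim(1)] elim(1) N by (intro integral_mono) auto
    also have "\<dots> = e' + 2 * B * (1 - (\<integral>x. cutoff n x \<partial>M i))"
      using int prob_space by simp
    also have "\<dots> \<le> e' + 2 * B * e'"
      using elim(2) \<open>B \<ge> 0\<close> by (intro add_left_mono mult_left_mono) auto
    also have "\<dots> < e"
      using \<open>e' * (1 + 2 * B) = e / 2\<close> \<open>e > 0\<close> by (simp add: algebra_simps)
    finally show ?case
      by simp
  qed
qed

text \<open>Replacing \<open>potential (M i)\<close> by \<open>potential N\<close> costs an error
  tending to 0; after that the integrand is a fixed bounded continuous function, to which weak
  convergence applies.\<close>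

lemma integral_potential_tendsto:
  assumes M: "eventually (\<lambda>i. real_distribution (M i)) F" and N: "real_distribution N"
    and conv: "weakly_converges M N F"
  shows "((\<lambda>i. \<integral>x. potential (M i) x \<partial>M i) \<longlongrightarrow> (\<integral>x. potential N x \<partial>N)) F"
proof -
  have "((\<lambda>i. \<integral>x. potential N x \<partial>M i) \<longlongrightarrow> (\<integral>x. potential N x \<partial>N)) F"
    using conv continuous_potential[OF N] bounded_potential[OF N]
    unfolding weakly_converges_def by blast
  from tendsto_add[OF integral_potential_diff_tendsto_0[OF assms] this]
  have "((\<lambda>i. (\<integral>x. potential (M i) x - potential N x \<partial>M i) + (\<integral>x. potential N x \<partial>M i))
      \<longlongrightarrow> (\<integral>x. potential N x \<partial>N)) F"
    by simp
  moreover have "eventually (\<lambda>i. (\<integral>x. potential (M i) x - potential N x \<partial>M i)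
      + (\<integral>x. potential N x \<partial>M i) = (\<integral>x. potential (M i) x \<partial>M i)) F"
    using M
  proof eventually_elim
    case (elim i)
    then show ?case
      using integrable_potential N by simp
  qed
  ultimately show ?thesis
    by (rule Lim_transform_eventually)
qed

end

section \<open>Energies of probability densities\<close>

lemma integral_density_measure:
  fixes f :: "real \<Rightarrow> real"
  assumes "\<rho> \<in> prob_densities" "f \<in> borel_measurable borel"
  shows "(\<integral>x. f x \<partial>density_measure \<rho>) = (\<integral>x. f x * \<rho> x \<partial>lborel)"
  using assms unfolding density_measure_def prob_densities_def
  by (subst integral_density) (auto simp: mult.commute)

lemma integrable_density_measure_iff:
  fixes f :: "real \<Rightarrow> real"
  assumes "\<rho> \<in> prob_densities" "f \<in> borel_measurable borel"
  shows "integrable (density_measure \<rho>) f \<longleftrightarrow> integrable lborel (\<lambda>x. f x * \<rho> x)"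
  using assms unfolding density_measure_def prob_densities_def
  by (subst integrable_density) (auto simp: mult.commute)

lemma real_distribution_density_measure:
  assumes "\<rho> \<in> prob_densities"
  shows "real_distribution (density_measure \<rho>)"
proof -
  have \<rho>: "integrable lborel \<rho>" "AE x in lborel. 0 \<le> \<rho> x" "(\<integral>x. \<rho> x \<partial>lborel) = 1"
    using assms by (auto simp: prob_densities_def)
  have "emeasure (density_measure \<rho>) UNIV = (\<integral>\<^sup>+x. ennreal (\<rho> x) \<partial>lborel)"
    using \<rho>(1) unfolding density_measure_def by (subst emeasure_density) auto
  also have "\<dots> = 1"
    using \<rho> by (simp add: nn_integral_eq_integral)
  finally have "prob_space (density_measure \<rho>)"
    by (intro prob_spaceI) (simp add: density_measure_def)
  then show ?thesis
    by (simp add: real_distribution_def real_distribution_axioms_def density_measure_def)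
qed

context interaction_kernel
begin

lemma convol_eq_potential:
  assumes "\<rho> \<in> prob_densities"
  shows "convol W \<rho> = potential (density_measure \<rho>)"
  unfolding convol_def potential_def
  by (subst integral_density_measure[OF assms])
     (auto intro!: borel_measurable_continuous_onI continuous_shift)

lemma measurable_convol:
  assumes "\<rho> \<in> prob_densities"
  shows "convol W \<rho> \<in> borel_measurable borel"
  unfolding convol_eq_potential[OF assms]
  by (intro borel_measurable_continuous_onI continuous_potential
      real_distribution_density_measure assms)

text \<open>The potential is bounded and continuous, hence integrable against a probability measure.
  This is what allows the regularised energy to be split into two integrals.\<close>

lemma integrable_convol:
  assumes "\<rho> \<in> prob_densities"
  shows "integrable lborel (\<lambda>x. \<rho> x * convol W \<rho> x)"
  using integrable_potential[OF real_distribution_density_measure real_distribution_density_measure,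
      OF assms assms]
    integrable_density_measure_iff[OF assms measurable_convol[OF assms]]
  by (simp add: convol_eq_potential[OF assms] mult.commute)

lemma energy_eq_potential:
  assumes "\<rho> \<in> prob_densities"
  shows "energy W \<rho> = 1/2 * (\<integral>x. potential (density_measure \<rho>) x \<partial>density_measure \<rho>)"
  using integral_density_measure[OF assms measurable_convol[OF assms]]
  by (simp add: energy_def convol_eq_potential[OF assms] mult.commute)

text \<open>Weak continuity of the interaction energy, on which both halves of the Gamma convergence
  rest. Membership is only eventual because the families are constrained only for
  \<open>\<delta> > 0\<close>.\<close>

lemma energy_tendsto:
  assumes "eventually (\<lambda>i. u i \<in> prob_densities) F" "\<rho> \<in> prob_densities"
    "weakly_converges (\<lambda>i. density_measure (u i)) (density_measure \<rho>) F"
  shows "((\<lambda>i. energy W (u i)) \<longlongrightarrow> energy W \<rho>) F"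
proof -
  have "eventually (\<lambda>i. real_distribution (density_measure (u i))) F"
    using assms(1) by eventually_elim (rule real_distribution_density_measure)
  then have "((\<lambda>i. 1/2 * (\<integral>x. potential (density_measure (u i)) x \<partial>density_measure (u i)))
      \<longlongrightarrow> energy W \<rho>) F"
    unfolding energy_eq_potential[OF assms(2)]
    by (intro tendsto_mult_left integral_potential_tendsto assms real_distribution_density_measure)
  moreover have "eventually (\<lambda>i. 1/2 * (\<integral>x. potential (density_measure (u i)) x
      \<partial>density_measure (u i)) = energy W (u i)) F"
    using assms(1) by eventually_elim (simp add: energy_eq_potential)
  ultimately show ?thesis
    by (rule Lim_transform_eventually)
qed

lemma reg_energy_eq:
  assumes "\<rho> \<in> prob_densities" "in_L2 \<rho>"
  shows "reg_energy W \<delta> \<rho> = ereal (energy W \<rho> + \<delta> / 2 * (\<integral>x. (\<rho> x)\<^sup>2 \<partial>lborel))"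
proof -
  have "(\<integral>x. \<rho> x * (convol W \<rho> x + \<delta> * \<rho> x) \<partial>lborel)
      = (\<integral>x. \<rho> x * convol W \<rho> x + \<delta> * (\<rho> x)\<^sup>2 \<partial>lborel)"
    by (intro Bochner_Integration.integral_cong) (auto simp: algebra_simps power2_eq_square)
  also have "\<dots> = (\<integral>x. \<rho> x * convol W \<rho> x \<partial>lborel) + \<delta> * (\<integral>x. (\<rho> x)\<^sup>2 \<partial>lborel)"
    using assms(2) integrable_convol[OF assms(1)] by (simp add: in_L2_def)
  finally show ?thesis
    using assms(2) by (simp add: reg_energy_def energy_def algebra_simps)
qed

text \<open>On L2 the difference is a nonnegative multiple of the squared norm; elsewhere the
  right-hand side is infinite.\<close>

lemma energy_le_reg_energy:
  assumes "\<rho> \<in> prob_densities" "\<delta> \<ge> 0"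
  shows "ereal (energy W \<rho>) \<le> reg_energy W \<delta> \<rho>"
proof (cases "in_L2 \<rho>")
  case True
  then show ?thesis
    using assms by (simp add: reg_energy_eq)
next
  case False
  then show ?thesis
    by (simp add: reg_energy_def)
qed

end

section \<open>Normalised truncations\<close>

definition truncation_mass :: "(real \<Rightarrow> real) \<Rightarrow> real \<Rightarrow> real" where
  "truncation_mass \<rho> m = (\<integral>x. min (\<rho> x) m \<partial>lborel)"

definition truncation :: "(real \<Rightarrow> real) \<Rightarrow> real \<Rightarrow> real \<Rightarrow> real" where
  "truncation \<rho> m x = min (\<rho> x) m / truncation_mass \<rho> m"

context
  fixes \<rho> :: "real \<Rightarrow> real"
  assumes \<rho>: "\<rho> \<in> prob_densities"
begin

lemma density_measurable [measurable]: "\<rho> \<in> borel_measurable borel"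
  and density_integrable: "integrable lborel \<rho>"
  and density_nonneg: "AE x in lborel. 0 \<le> \<rho> x"
  and density_integral: "(\<integral>x. \<rho> x \<partial>lborel) = 1"
  using \<rho> by (auto simp: prob_densities_def)

lemma integrable_min:
  assumes "m \<ge> 0"
  shows "integrable lborel (\<lambda>x. min (\<rho> x) m)"
  by (rule Bochner_Integration.integrable_bound[OF density_integrable])
     (use density_nonneg assms in auto)

text \<open>Zero mass would make \<open>min (\<rho> x) m\<close> vanish almost everywhere; as
  \<open>m > 0\<close>, so would \<open>\<rho>\<close>, contradicting total mass 1.\<close>

lemma truncation_mass_pos:
  assumes "m > 0"
  shows "truncation_mass \<rho> m > 0"
proof (rule ccontr)
  have nonneg: "AE x in lborel. 0 \<le> min (\<rho> x) m"
    using density_nonneg by eventually_elim (use assms in auto)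
  assume "\<not> ?thesis"
  moreover have "0 \<le> truncation_mass \<rho> m"
    unfolding truncation_mass_def by (rule integral_nonneg_AE[OF nonneg])
  ultimately have "(\<integral>x. min (\<rho> x) m \<partial>lborel) = 0"
    by (simp add: truncation_mass_def)
  then have "AE x in lborel. min (\<rho> x) m = 0"
    using integral_nonneg_eq_0_iff_AE[OF integrable_min nonneg] assms by simp
  then have "AE x in lborel. \<rho> x = 0"
    by eventually_elim (use assms in \<open>auto simp: min_def split: if_splits\<close>)
  then have "(\<integral>x. \<rho> x \<partial>lborel) = 0"
    by (rule integral_eq_zero_AE)
  then show False
    using density_integral by simp
qed

lemma truncation_in_prob_densities:
  assumes "m > 0"
  shows "truncation \<rho> m \<in> prob_densities"
proof -
  have "AE x in lborel. 0 \<le> truncation \<rho> m x"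
    using density_nonneg
    by eventually_elim (use assms truncation_mass_pos[OF assms] in \<open>auto simp: truncation_def\<close>)
  moreover have "integrable lborel (truncation \<rho> m)"
    unfolding truncation_def using integrable_min assms by auto
  moreover have "(\<integral>x. truncation \<rho> m x \<partial>lborel) = 1"
    unfolding truncation_def using truncation_mass_pos[OF assms]
    by (simp add: truncation_mass_def)
  ultimately show ?thesis
    by (simp add: prob_densities_def)
qed

text \<open>One factor \<open>min (\<rho> x) m\<close> of the square is bounded by \<open>m\<close>.
  Since the truncation has mass 1, integrating this yields both square integrability and the norm
  bound.\<close>

lemma truncation_sq_le:
  assumes "m > 0"
  shows "AE x in lborel. (truncation \<rho> m x)\<^sup>2 \<le> m / truncation_mass \<rho> m * truncation \<rho> m x"
  using density_nonneg
proof eventually_elim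
  case (elim x)
  then have "min (\<rho> x) m * min (\<rho> x) m \<le> m * min (\<rho> x) m"
    using assms by (intro mult_right_mono) auto
  then show ?case
    using truncation_mass_pos[OF assms]
    by (simp add: truncation_def power2_eq_square divide_right_mono)
qed

lemma truncation_in_L2:
  assumes "m > 0"
  shows "in_L2 (truncation \<rho> m)"
proof -
  have meas: "truncation \<rho> m \<in> borel_measurable borel"
    unfolding truncation_def by measurable
  have "integrable lborel (\<lambda>x. m / truncation_mass \<rho> m * truncation \<rho> m x)"
    using truncation_in_prob_densities[OF assms] by (simp add: prob_densities_def)
  then have "integrable lborel (\<lambda>x. (truncation \<rho> m x)\<^sup>2)"
  proof (rule Bochner_Integration.integrable_bound)
    show "AE x in lborel. norm ((truncation \<rho> m x)\<^sup>2)
        \<le> norm (m / truncation_mass \<rho> m * truncation \<rho> m x)"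
      using truncation_sq_le[OF assms]
    proof eventually_elim
      case (elim x)
      show ?case
        unfolding real_norm_def abs_power2 by (rule order_trans[OF elim abs_ge_self])
    qed
  qed (use meas in auto)
  with meas show ?thesis
    by (simp add: in_L2_def)
qed

lemma integral_truncation_sq_le:
  assumes "m > 0"
  shows "(\<integral>x. (truncation \<rho> m x)\<^sup>2 \<partial>lborel) \<le> m / truncation_mass \<rho> m"
proof -
  have "(\<integral>x. (truncation \<rho> m x)\<^sup>2 \<partial>lborel)
      \<le> (\<integral>x. m / truncation_mass \<rho> m * truncation \<rho> m x \<partial>lborel)"
    using truncation_sq_le[OF assms] truncation_in_L2[OF assms] truncation_in_prob_densities[OF assms]
    by (intro integral_mono_AE) (auto simp: in_L2_def prob_densities_def)
  also have "\<dots> = m / truncation_mass \<rho> m"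
    using truncation_in_prob_densities[OF assms] by (simp add: prob_densities_def)
  finally show ?thesis .
qed

text \<open>Dominated convergence: for fixed \<open>x\<close> the integrand is constant once
  \<open>m\<close> exceeds \<open>\<rho> x\<close>. Taking \<open>f = 1\<close> gives the limit of
  the normalising mass, a general \<open>f\<close> the weak limit.\<close>

lemma integral_min_tendsto:
  fixes f :: "real \<Rightarrow> real"
  assumes [measurable]: "f \<in> borel_measurable borel" and "bounded (range f)"
  shows "((\<lambda>m. \<integral>x. f x * min (\<rho> x) m \<partial>lborel) \<longlongrightarrow> (\<integral>x. f x * \<rho> x \<partial>lborel)) at_top"
proof -
  obtain C where C: "\<And>x. \<bar>f x\<bar> \<le> C"
    using assms(2) by (auto simp: bounded_iff)
  show ?thesis
  proof (rule integral_dominated_convergence_at_top[where w="\<lambda>x. C * \<rho> x"])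
    show "integrable lborel (\<lambda>x. C * \<rho> x)"
      using density_integrable by simp
    show "AE x in lborel. ((\<lambda>m. f x * min (\<rho> x) m) \<longlongrightarrow> f x * \<rho> x) at_top"
    proof (intro always_eventually allI)
      fix x
      have "eventually (\<lambda>m. f x * min (\<rho> x) m = f x * \<rho> x) at_top"
        using eventually_ge_at_top[of "\<rho> x"] by eventually_elim simp
      then show "((\<lambda>m. f x * min (\<rho> x) m) \<longlongrightarrow> f x * \<rho> x) at_top"
        by (rule tendsto_eventually)
    qed
    \<comment> \<open>Domination holds only from \<open>m = 0\<close> on: for negative
      \<open>m\<close> the minimum can exceed \<open>\<rho> x\<close> in absolute value.\<close>
    show "\<forall>\<^sub>F m in at_top. AE x in lborel. norm (f x * min (\<rho> x) m) \<le> C * \<rho> x"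
      using eventually_ge_at_top[of 0]
    proof (rule eventually_mono)
      fix m :: real
      assume "0 \<le> m"
      show "AE x in lborel. norm (f x * min (\<rho> x) m) \<le> C * \<rho> x"
        using density_nonneg
      proof eventually_elim
        case (elim x)
        then have "\<bar>f x\<bar> * \<bar>min (\<rho> x) m\<bar> \<le> C * \<rho> x"
          using C[of x] \<open>0 \<le> m\<close> by (intro mult_mono) auto
        then show ?case
          by (simp add: abs_mult)
      qed
    qed
  qed auto
qed

lemma truncation_mass_tendsto: "(truncation_mass \<rho> \<longlongrightarrow> 1) at_top"
  using integral_min_tendsto[of "\<lambda>_. 1"] density_integral by (simp add: truncation_mass_def[abs_def])

lemma truncation_weakly_converges:
  "weakly_converges (\<lambda>m. density_measure (truncation \<rho> m)) (density_measure \<rho>) at_top"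
  unfolding weakly_converges_def
proof (intro allI impI)
  fix f :: "real \<Rightarrow> real"
  assume f: "continuous_on UNIV f \<and> bounded (range f)"
  then have meas: "f \<in> borel_measurable borel"
    by (intro borel_measurable_continuous_onI) auto
  have "((\<lambda>m. (\<integral>x. f x * min (\<rho> x) m \<partial>lborel) / truncation_mass \<rho> m)
      \<longlongrightarrow> (\<integral>x. f x * \<rho> x \<partial>lborel) / 1) at_top"
    using f meas by (intro tendsto_divide integral_min_tendsto truncation_mass_tendsto) auto
  then have "((\<lambda>m. (\<integral>x. f x * min (\<rho> x) m \<partial>lborel) / truncation_mass \<rho> m)
      \<longlongrightarrow> (\<integral>x. f x \<partial>density_measure \<rho>)) at_top"
    by (simp add: integral_density_measure[OF \<rho> meas])
  moreover have "eventually (\<lambda>m. (\<integral>x. f x * min (\<rho> x) m \<partial>lborel) / truncation_mass \<rho> m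
      = (\<integral>x. f x \<partial>density_measure (truncation \<rho> m))) at_top"
    using eventually_gt_at_top[of 0]
    by eventually_elim
       (simp add: integral_density_measure[OF truncation_in_prob_densities meas] truncation_def)
  ultimately show "((\<lambda>m. \<integral>x. f x \<partial>density_measure (truncation \<rho> m))
      \<longlongrightarrow> (\<integral>x. f x \<partial>density_measure \<rho>)) at_top"
    by (rule Lim_transform_eventually)
qed

text \<open>A truncation height \<open>m\<close> costs at most \<open>\<delta> * m / 2\<close>
  divided by the mass. The height \<open>1 / sqrt \<delta>\<close> tends to infinity, so the mass
  tends to 1, while \<open>\<delta> * m = sqrt \<delta>\<close> still tends to 0.\<close>

lemma scaled_integral_truncation_sq_tendsto_0:
  "((\<lambda>\<delta>. \<delta> / 2 * (\<integral>x. (truncation \<rho> (1 / sqrt \<delta>) x)\<^sup>2 \<partial>lborel)) \<longlongrightarrow> 0) (at_right 0)"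
proof (rule tendsto_sandwich)
  show "eventually (\<lambda>\<delta>. 0 \<le> \<delta> / 2 * (\<integral>x. (truncation \<rho> (1 / sqrt \<delta>) x)\<^sup>2 \<partial>lborel)) (at_right 0)"
    using eventually_at_right_less[of 0] by eventually_elim simp
  show "eventually (\<lambda>\<delta>. \<delta> / 2 * (\<integral>x. (truncation \<rho> (1 / sqrt \<delta>) x)\<^sup>2 \<partial>lborel)
      \<le> sqrt \<delta> / 2 / truncation_mass \<rho> (1 / sqrt \<delta>)) (at_right 0)"
    using eventually_at_right_less[of 0]
  proof eventually_elim
    case (elim \<delta>)
    then have "\<delta> / 2 * (\<integral>x. (truncation \<rho> (1 / sqrt \<delta>) x)\<^sup>2 \<partial>lborel)
        \<le> \<delta> / 2 * (1 / sqrt \<delta> / truncation_mass \<rho> (1 / sqrt \<delta>))"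
      by (intro mult_left_mono integral_truncation_sq_le) auto
    also have "\<dots> = (\<delta> / sqrt \<delta>) / 2 / truncation_mass \<rho> (1 / sqrt \<delta>)"
      by simp
    also have "\<delta> / sqrt \<delta> = sqrt \<delta>"
      using elim by (simp add: real_div_sqrt)
    finally show ?case .
  qed
  have "((\<lambda>\<delta>. truncation_mass \<rho> (1 / sqrt \<delta>)) \<longlongrightarrow> 1) (at_right 0)"
    by (rule filterlim_compose[OF truncation_mass_tendsto]) real_asymp
  moreover have "((\<lambda>\<delta>. sqrt \<delta> / 2) \<longlongrightarrow> 0) (at_right 0)"
    by real_asymp
  ultimately show "((\<lambda>\<delta>. sqrt \<delta> / 2 / truncation_mass \<rho> (1 / sqrt \<delta>)) \<longlongrightarrow> 0) (at_right 0)"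
    using tendsto_divide by fastforce
qed auto

end

section \<open>Gamma convergence\<close>

context interaction_kernel
begin

text \<open>Dropping the nonnegative penalty leaves the interaction energies, which converge by weak
  continuity.\<close>

lemma gamma_liminf:
  assumes "\<And>\<delta>. \<delta> > 0 \<Longrightarrow> u \<delta> \<in> prob_densities" "\<rho> \<in> prob_densities"
    "weakly_converges (\<lambda>\<delta>. density_measure (u \<delta>)) (density_measure \<rho>) (at_right 0)"
  shows "ereal (energy W \<rho>) \<le> Liminf (at_right 0) (\<lambda>\<delta>. reg_energy W \<delta> (u \<delta>))"
proof -
  have u: "eventually (\<lambda>\<delta>. u \<delta> \<in> prob_densities) (at_right 0)"
    using eventually_at_right_less[of 0] by eventually_elim (rule assms)
  have "((\<lambda>\<delta>. ereal (energy W (u \<delta>))) \<longlongrightarrow> ereal (energy W \<rho>)) (at_right 0)"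
    using energy_tendsto[OF u assms(2,3)] by simp
  then have "ereal (energy W \<rho>) = Liminf (at_right 0) (\<lambda>\<delta>. ereal (energy W (u \<delta>)))"
    by (intro lim_imp_Liminf[symmetric]) auto
  also have "\<dots> \<le> Liminf (at_right 0) (\<lambda>\<delta>. reg_energy W \<delta> (u \<delta>))"
    using eventually_at_right_less[of 0]
    by (intro Liminf_mono, eventually_elim) (auto intro!: energy_le_reg_energy assms)
  finally show ?thesis .
qed

text \<open>Along the normalised truncations the energies actually converge, which is stronger than
  the limsup inequality.\<close>

lemma gamma_recovery:
  assumes "\<rho> \<in> prob_densities"
  obtains u where "\<And>\<delta>. \<delta> > 0 \<Longrightarrow> u \<delta> \<in> prob_densities"
    "weakly_converges (\<lambda>\<delta>. density_measure (u \<delta>)) (density_measure \<rho>) (at_right 0)"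
    "((\<lambda>\<delta>. reg_energy W \<delta> (u \<delta>)) \<longlongrightarrow> ereal (energy W \<rho>)) (at_right 0)"
proof (rule that)
  define u where "u = (\<lambda>\<delta>. truncation \<rho> (1 / sqrt \<delta>))"
  show u: "u \<delta> \<in> prob_densities" if "\<delta> > 0" for \<delta>
    using that unfolding u_def by (intro truncation_in_prob_densities assms) simp
  have lim: "filterlim (\<lambda>\<delta>::real. 1 / sqrt \<delta>) at_top (at_right 0)"
    by real_asymp
  show conv: "weakly_converges (\<lambda>\<delta>. density_measure (u \<delta>)) (density_measure \<rho>) (at_right 0)"
    \<comment> \<open>For each test function, the limit in the height \<open>m\<close> is composed
      with \<open>m = 1 / sqrt \<delta>\<close>.\<close>
    using truncation_weakly_converges[OF assms] filterlim_compose[OF _ lim]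
    unfolding weakly_converges_def u_def by fast
  have ev: "eventually (\<lambda>\<delta>. u \<delta> \<in> prob_densities) (at_right 0)"
    using eventually_at_right_less[of 0] by eventually_elim (rule u)
  have "((\<lambda>\<delta>. energy W (u \<delta>) + \<delta> / 2 * (\<integral>x. (u \<delta> x)\<^sup>2 \<partial>lborel))
      \<longlongrightarrow> energy W \<rho> + 0) (at_right 0)"
    using scaled_integral_truncation_sq_tendsto_0[OF assms]
    by (intro tendsto_add energy_tendsto ev conv assms) (simp add: u_def)
  then have "((\<lambda>\<delta>. ereal (energy W (u \<delta>) + \<delta> / 2 * (\<integral>x. (u \<delta> x)\<^sup>2 \<partial>lborel)))
      \<longlongrightarrow> ereal (energy W \<rho>)) (at_right 0)"
    by simp
  moreover have "eventually (\<lambda>\<delta>. ereal (energy W (u \<delta>) + \<delta> / 2 * (\<integral>x. (u \<delta> x)\<^sup>2 \<partial>lborel))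
      = reg_energy W \<delta> (u \<delta>)) (at_right 0)"
    using eventually_at_right_less[of 0]
  proof eventually_elim
    case (elim \<delta>)
    then have "in_L2 (u \<delta>)"
      unfolding u_def by (intro truncation_in_L2 assms) simp
    with elim show ?case
      by (simp add: reg_energy_eq u)
  qed
  ultimately show "((\<lambda>\<delta>. reg_energy W \<delta> (u \<delta>)) \<longlongrightarrow> ereal (energy W \<rho>)) (at_right 0)"
    by (rule Lim_transform_eventually)
qed

end

section \<open>From smoothness of the kernel to boundedness and uniform continuity\<close>

text \<open>The derivative is bounded on a compact interval and zero outside, so \<open>W\<close> is
  Lipschitz; being constant on both outer half-lines, it is also bounded.\<close>

lemma interaction_kernel_if_C1_flat:
  fixes W :: "real \<Rightarrow> real"
  assumes C1: "W C1_differentiable_on UNIV"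
    and flat: "\<And>x. \<bar>x\<bar> \<ge> r \<Longrightarrow> deriv W x = 0"
  obtains B where "interaction_kernel W B"
proof -
  have DERIV: "(W has_real_derivative deriv W x) (at x)" for x
    using C1 by (metis C1_differentiable_on_eq DERIV_deriv_iff_real_differentiable UNIV_I)
  have cont: "continuous_on UNIV (deriv W)"
    using C1 unfolding C1_differentiable_on_eq
    by (simp add: vector_derivative_at[OF DERIV[unfolded has_real_derivative_iff_has_vector_derivative]])
  have "compact (deriv W ` {-r..r})"
    by (intro compact_continuous_image continuous_on_subset[OF cont]) auto
  then obtain L where L: "\<And>x. x \<in> {-r..r} \<Longrightarrow> \<bar>deriv W x\<bar> \<le> L"
    using compact_imp_bounded by (fastforce simp: bounded_iff)
  \<comment> \<open>The sign of \<open>r\<close> is not prescribed: for \<open>r < 0\<close> the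
    interval is empty and \<open>L\<close> may be negative, hence the maximum with 0.\<close>
  have L': "\<bar>deriv W x\<bar> \<le> max L 0" for x
    using L[of x] flat[of x] by (cases "\<bar>x\<bar> \<le> r") (auto simp: abs_le_iff max_def)
  have lip: "\<bar>W x - W y\<bar> \<le> max L 0 * \<bar>x - y\<bar>" for x y
    using field_differentiable_bound[of UNIV W "deriv W" "max L 0" x y] DERIV L'
    by (auto simp: has_field_derivative_at_within)
  have "uniformly_continuous_on UNIV W"
    by (rule lipschitz_on_uniformly_continuous[of "max L 0"])
       (auto simp: lipschitz_on_def dist_real_def lip)
  \<comment> \<open>The sum covers all three regions at once: \<open>W (-r)\<close> on the left,
    \<open>W r\<close> on the right, and \<open>W 0\<close> plus the Lipschitz term in the
    middle.\<close>
  moreover have "\<bar>W x\<bar> \<le> \<bar>W 0\<bar> + \<bar>W r\<bar> + \<bar>W (-r)\<bar> + max L 0 * \<bar>r\<bar>" for x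
  proof -
    \<comment> \<open>The mean value theorem evaluates the derivative only at an interior point, so
      flatness inside the interval is enough.\<close>
    have const: "W a = W b" if "a < b" "\<And>z. a < z \<Longrightarrow> z < b \<Longrightarrow> \<bar>z\<bar> \<ge> r" for a b
      using MVT2[OF that(1), of W "deriv W"] DERIV flat that(2) by force
    have "0 \<le> max L 0 * \<bar>r\<bar>" by simp
    consider "x < -r" | "r < x" | "\<bar>x\<bar> \<le> \<bar>r\<bar>" by linarith
    then show ?thesis
    proof cases
      case 1
      then have "W x = W (-r)" by (intro const) auto
      with \<open>0 \<le> max L 0 * \<bar>r\<bar>\<close> show ?thesis by linarith
    next
      case 2
      then have "W r = W x" by (intro const) auto
      with \<open>0 \<le> max L 0 * \<bar>r\<bar>\<close> show ?thesis by linarith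
    next
      case 3
      then have "max L 0 * \<bar>x\<bar> \<le> max L 0 * \<bar>r\<bar>" by (intro mult_left_mono) auto
      with lip[of x 0] show ?thesis unfolding diff_zero by linarith
    qed
  qed
  ultimately show ?thesis
    by (intro that interaction_kernel.intro)
qed

theorem theorem2p7:
  fixes W :: "real \<Rightarrow> real"
  assumes even: "\<And>x. W x = W (- x)"
    and C1: "W C1_differentiable_on UNIV"
    and flat: "\<And>x. \<bar>x\<bar> \<ge> 1/2 \<Longrightarrow> deriv W x = 0"
  shows "gamma_converges prob_densities
           (\<lambda>\<rho>\<^sub>\<delta> \<rho>. weakly_converges (\<lambda>\<delta>. density_measure (\<rho>\<^sub>\<delta> \<delta>)) (density_measure \<rho>) (at_right 0))
           (\<lambda>\<delta> \<rho>. reg_energy W \<delta> \<rho>) (\<lambda>\<rho>. ereal (energy W \<rho>))"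
proof -
  obtain B where "interaction_kernel W B"
    using interaction_kernel_if_C1_flat[OF C1 flat] by blast
  then interpret interaction_kernel W B .
  show ?thesis
    unfolding gamma_converges_def
  proof (intro conjI allI impI ballI)
    fix u :: "real \<Rightarrow> real \<Rightarrow> real" and \<rho>
    assume "(\<forall>\<delta>>0. u \<delta> \<in> prob_densities) \<and> \<rho> \<in> prob_densities \<and>
      weakly_converges (\<lambda>\<delta>. density_measure (u \<delta>)) (density_measure \<rho>) (at_right 0)"
    then show "ereal (energy W \<rho>) \<le> Liminf (at_right 0) (\<lambda>\<delta>. reg_energy W \<delta> (u \<delta>))"
      by (intro gamma_liminf) auto
  next
    fix \<rho>
    assume "\<rho> \<in> prob_densities"
    then obtain u where u: "\<And>\<delta>. \<delta> > 0 \<Longrightarrow> u \<delta> \<in> prob_densities"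
      "weakly_converges (\<lambda>\<delta>. density_measure (u \<delta>)) (density_measure \<rho>) (at_right 0)"
      "((\<lambda>\<delta>. reg_energy W \<delta> (u \<delta>)) \<longlongrightarrow> ereal (energy W \<rho>)) (at_right 0)"
      using gamma_recovery by blast
    from u(3) have "Limsup (at_right 0) (\<lambda>\<delta>. reg_energy W \<delta> (u \<delta>)) = ereal (energy W \<rho>)"
      by (intro lim_imp_Limsup) auto
    with u show "\<exists>u. (\<forall>\<delta>>0. u \<delta> \<in> prob_densities) \<and>
        weakly_converges (\<lambda>\<delta>. density_measure (u \<delta>)) (density_measure \<rho>) (at_right 0) \<and>
        Limsup (at_right 0) (\<lambda>\<delta>. reg_energy W \<delta> (u \<delta>)) \<le> ereal (energy W \<rho>)"
      by (intro exI[of _ u]) auto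
  qed
qed

end
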